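(* Let $\Omega=\mathbb{R}\times\mathbb{R}^+\subset\mathbb{R}^2$, and let $\phi:\mathbb{R}\to\mathbb{R}$ be a real-valued, measurable, essentially bounded function such that $\lim_{x\to\infty}\phi(x)$ a.e. and $\lim_{x\to-\infty}\phi(x)$ a.e. exist. Then for every $p$ with $1\le p<\infty$, $$\mathcal{S}_2(\phi)\cap L^p(\Omega)=\{0\}$$ as a subset of $L^p(\Omega)$; that is, every $F\in\mathcal{S}_2(\phi)$ with $F|_\Omega\in L^p(\Omega)$ vanishes almost everywhere on $\Omega$.
   Context: $\mathbb{R}^+$ is the set of positive real numbers. For a function $\phi:\mathbb{R}\to\mathbb{R}$ and an integer $m\ge1$, $\mathcal{S}_m(\phi)$ denotes the set of all functions on $\mathbb{R}^m$ of the form $x\mapsto\sum_{i=1}^k t_i\,\phi(\langle y_i,x\rangle+\varrho_i)$ with $k\in\mathbb{N}$, $t_i,\varrho_i\in\mathbb{R}$, $y_i\in\mathbb{R}^m$ (dot product $\langle\cdot,\cdot\rangle$). $\phi$ is essentially bounded if it is bounded off a Lebesgue-null set. One writes $\lim_{t\to x}\phi(t)=c$ a.e. if there is a null set $Z$ with $\lim_{t\notin Z,\,t\to x}\phi(t)=c$ (here $x=\pm\infty$). $L^p(\Omega)$ is with respect to Lebesgue measure. *)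

theory Defs
  imports "HOL-Analysis.Analysis"
begin

definition ridge_sums :: "(real \<Rightarrow> real) \<Rightarrow> (real ^ 'm \<Rightarrow> real) set" where
  "ridge_sums \<phi> =
     {F. \<exists>(k::nat) (t::nat \<Rightarrow> real) (y::nat \<Rightarrow> real ^ 'm) (\<rho>::nat \<Rightarrow> real).
           F = (\<lambda>x. \<Sum>i<k. t i * \<phi> (y i \<bullet> x + \<rho> i))}"

definition essentially_bounded :: "(real \<Rightarrow> real) \<Rightarrow> bool" where
  "essentially_bounded \<phi> \<longleftrightarrow> (\<exists>Z \<in> null_sets lebesgue. bounded (\<phi> ` (- Z)))"

text \<open>The limit is taken along a filter, so that \<open>at_top\<close> and \<open>at_bot\<close> give the limits at plus
  and minus infinity.\<close>

definition tendsto_ae :: "(real \<Rightarrow> real) \<Rightarrow> real \<Rightarrow> real filter \<Rightarrow> bool" where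
  "tendsto_ae \<phi> c \<F> \<longleftrightarrow> (\<exists>Z \<in> null_sets lebesgue. (\<phi> \<longlongrightarrow> c) (inf \<F> (principal (- Z))))"

definition upper_half_plane :: "(real ^ 2) set" where
  "upper_half_plane = {x. x $ 2 > 0}"

text \<open>Functions are total, but only their restriction to \<open>\<Omega>\<close> matters in the next two
  definitions: \<open>Lp_fun p \<Omega>\<close> consists of the representatives of elements of \<open>L\<^sup>p(\<Omega>)\<close>, and the
  elements of \<open>L\<^sup>p(\<Omega>)\<close> are the equivalence classes of \<open>Lp_eq p \<Omega>\<close>.\<close>

definition Lp_fun :: "real \<Rightarrow> 'a::euclidean_space set \<Rightarrow> ('a \<Rightarrow> real) set" where
  "Lp_fun p \<Omega> = {F. F \<in> borel_measurable (lebesgue_on \<Omega>) \<and>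
                     integrable (lebesgue_on \<Omega>) (\<lambda>x. \<bar>F x\<bar> powr p)}"

definition Lp_eq :: "real \<Rightarrow> 'a::euclidean_space set \<Rightarrow> (('a \<Rightarrow> real) \<times> ('a \<Rightarrow> real)) set" where
  "Lp_eq p \<Omega> = {(F, G). F \<in> Lp_fun p \<Omega> \<and> G \<in> Lp_fun p \<Omega> \<and> (AE x in lebesgue_on \<Omega>. F x = G x)}"

definition Lp_class :: "real \<Rightarrow> 'a::euclidean_space set \<Rightarrow> ('a \<Rightarrow> real) \<Rightarrow> ('a \<Rightarrow> real) set" where
  "Lp_class p \<Omega> F = Lp_eq p \<Omega> `` {F}"

lemma equiv_Lp_eq: "equiv (Lp_fun p \<Omega>) (Lp_eq p \<Omega>)"
proof (rule equivI)
  show "Lp_eq p \<Omega> \<subseteq> Lp_fun p \<Omega> \<times> Lp_fun p \<Omega>"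
    by (auto simp: Lp_eq_def)
  show "refl_on (Lp_fun p \<Omega>) (Lp_eq p \<Omega>)"
    by (auto simp: refl_on_def Lp_eq_def)
  show "sym (Lp_eq p \<Omega>)"
    by (auto simp: sym_def Lp_eq_def eq_commute)
  show "trans (Lp_eq p \<Omega>)"
    by (rule transI) (auto simp: Lp_eq_def)
qed

lemma zero_in_Lp_fun: "(\<lambda>_. 0) \<in> Lp_fun p \<Omega>"
  by (simp add: Lp_fun_def)

lemma zero_in_ridge_sums: "(\<lambda>_. 0) \<in> ridge_sums \<phi>"
  unfolding ridge_sums_def by (auto intro!: exI[of _ "0::nat"])

lemma Lp_class_eq_zero_iff:
  assumes "F \<in> Lp_fun p \<Omega>"
  shows "Lp_class p \<Omega> F = Lp_class p \<Omega> (\<lambda>_. 0) \<longleftrightarrow> (AE x in lebesgue_on \<Omega>. F x = 0)"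
  unfolding Lp_class_def
  using eq_equiv_class_iff[OF equiv_Lp_eq assms zero_in_Lp_fun] assms zero_in_Lp_fun[of p \<Omega>]
  by (simp add: Lp_eq_def)

lemma Lp_class_image_eq_zero_iff:
  "Lp_class p \<Omega> ` (ridge_sums \<phi> \<inter> Lp_fun p \<Omega>) = {Lp_class p \<Omega> (\<lambda>_. 0)} \<longleftrightarrow>
     (\<forall>F \<in> ridge_sums \<phi> \<inter> Lp_fun p \<Omega>. AE x in lebesgue_on \<Omega>. F x = 0)"
proof -
  have "Lp_class p \<Omega> ` (ridge_sums \<phi> \<inter> Lp_fun p \<Omega>) = {Lp_class p \<Omega> (\<lambda>_. 0)} \<longleftrightarrow>
     (\<forall>F \<in> ridge_sums \<phi> \<inter> Lp_fun p \<Omega>. Lp_class p \<Omega> F = Lp_class p \<Omega> (\<lambda>_. 0))"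
    using zero_in_Lp_fun[of p \<Omega>] zero_in_ridge_sums[of \<phi>] by blast
  then show ?thesis
    by (simp add: Lp_class_eq_zero_iff)
qed

end

theory Submission imports Defs
begin

text \<open>Translate \<open>F\<close> along a direction \<open>v\<close> that keeps the half plane invariant. Integrability
  forces \<open>F (x + n v) \<rightarrow> 0\<close> for almost every \<open>x\<close>, while each ridge term whose direction is not
  orthogonal to \<open>v\<close> tends to one of the limits of \<open>\<phi>\<close> and the other terms do not change. Hence the
  ridge terms orthogonal to \<open>v\<close> add up to a constant almost everywhere. Every line in the plane is
  orthogonal to such a \<open>v\<close>, so \<open>F\<close>, grouped by the lines spanned by the \<open>y i\<close>, is almost everywhere
  constant, and the constant is \<open>0\<close> because the translates of \<open>F\<close> tend to \<open>0\<close>.\<close>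

section \<open>Null sets under translations and affine forms\<close>

lemma AE_lborel_translate:
  fixes v :: "'a::euclidean_space"
  assumes "AE x in lborel. P x"
  shows "AE x in lborel. P (x + v)"
proof -
  obtain N where N: "N \<in> null_sets lborel" "{x. \<not> P x} \<subseteq> N"
    using assms by (auto simp: eventually_ae_filter)
  then have [measurable]: "N \<in> sets borel" by auto
  have "AE x in lborel. x \<notin> N"
    using N(1) by (rule AE_not_in)
  then have "AE x in distr lborel borel ((+) v). x \<notin> N"
    by (subst lborel_distr_plus)
  then have "AE x in lborel. v + x \<notin> N"
    by (subst (asm) AE_distr_iff) auto
  then show ?thesis
    using N(2) by (auto elim!: eventually_mono simp: add.commute)
qed

text \<open>Fubini and translation invariance: the slices \<open>{s. y \<bullet> x + s \<in> Z}\<close> are null for every \<open>x\<close>, so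
  \<open>{x. y \<bullet> x + s \<in> Z}\<close> is null for some \<open>s\<close>, and these sets are translates of each other.\<close>

lemma AE_inner_notin_null_set:
  fixes y :: "'a::euclidean_space" and b :: real
  assumes Z: "Z \<in> null_sets lebesgue" and "y \<noteq> 0"
  shows "AE x in lborel. y \<bullet> x + b \<notin> Z"
proof -
  \<comment> \<open>A Borel null superset of \<open>Z\<close> makes the condition on
    \<open>x\<close> and \<open>s\<close> measurable on the product, as Fubini requires.\<close>
  obtain N where N: "N \<in> null_sets lborel" "Z \<subseteq> N"
    using Z by (auto simp: null_sets_completion_iff2)
  then have [measurable]: "N \<in> sets borel" by auto
  have "AE s in lborel. s \<notin> N"
    using N(1) by (rule AE_not_in)
  then have "AE s in lborel. y \<bullet> x + s \<notin> N" for x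
    using AE_lborel_translate[of "\<lambda>s. s \<notin> N" "y \<bullet> x"] by (simp add: add.commute)
  then have "AE x in lborel. AE s in lborel. y \<bullet> x + s \<notin> N"
    by simp
  then have "AE s in lborel. AE x in lborel. y \<bullet> x + s \<notin> N"
    by (subst (asm) lborel_pair.AE_commute) measurable
  then have "\<exists>s. AE x in lborel. y \<bullet> x + s \<notin> N"
    using eventually_happens'[of "ae_filter (lborel :: real measure)"]
    by (simp add: trivial_limit_def AE_iff_null emeasure_lborel_UNIV null_sets_def)
  then obtain s where "AE x in lborel. y \<bullet> x + s \<notin> N" ..
  \<comment> \<open>Moving \<open>x\<close> by this multiple of \<open>y\<close> changes
    \<open>y \<bullet> x\<close> by \<open>b - s\<close>, which turns the offset \<open>s\<close>
    into \<open>b\<close>.\<close>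
  then have "AE x in lborel. y \<bullet> (x + ((b - s) / (y \<bullet> y)) *\<^sub>R y) + s \<notin> N"
    by (rule AE_lborel_translate)
  then show ?thesis
    using N(2) \<open>y \<noteq> 0\<close> by (auto elim!: eventually_mono simp: inner_add_right)
qed

section \<open>Decay along translates\<close>

text \<open>Cut the space into slabs across \<open>v\<close>. The translates of one slab by
  multiples of \<open>v\<close> are disjoint, so the integrals of the shifted
  \<open>\<bar>g\<bar>\<close> over that slab sum to at most the integral of
  \<open>\<bar>g\<bar>\<close>. The series of shifts therefore converges almost everywhere on the
  slab, and its terms tend to zero.\<close>

lemma AE_translates_tendsto_zero:
  fixes g :: "'a::euclidean_space \<Rightarrow> real" and v :: 'a
  assumes g: "integrable lborel g" and "v \<noteq> 0"
  shows "AE x in lborel. (\<lambda>n. g (x + real n *\<^sub>R v)) \<longlonglongrightarrow> 0"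
proof -
  have [measurable]: "g \<in> borel_measurable borel"
    using g by auto
  \<comment> \<open>The coordinate \<open>h\<close> grows by exactly \<open>1\<close> under
    translation by \<open>v\<close>, so its integer part indexes the slabs.\<close>
  define h where "h x = x \<bullet> v / (v \<bullet> v)" for x
  have [measurable]: "h \<in> borel_measurable borel"
    unfolding h_def by measurable
  define B where "B m = {x. \<lfloor>h x\<rfloor> = m}" for m
  have [measurable]: "B m \<in> sets borel" for m
    unfolding B_def by measurable
  have h_shift: "h (x - real n *\<^sub>R v) = h x - real n" for x n
    using \<open>v \<noteq> 0\<close> by (simp add: h_def inner_diff_left diff_divide_distrib)
  have ae: "AE x in lborel. x \<in> B m \<longrightarrow> (\<lambda>n. g (x + real n *\<^sub>R v)) \<longlonglongrightarrow> 0" for m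
  proof -
    have disj: "disjoint_family (\<lambda>n::nat. {x. x - real n *\<^sub>R v \<in> B m})"
      unfolding disjoint_family_on_def B_def by (auto simp: h_shift) linarith
    \<comment> \<open>A change of variables trades shifts of \<open>g\<close> over one slab for
      \<open>g\<close> itself over shifted slabs.\<close>
    have shift: "(\<integral>\<^sup>+x. ennreal \<bar>g (x + real n *\<^sub>R v)\<bar> * indicator (B m) x \<partial>lborel)
        = (\<integral>\<^sup>+x. ennreal \<bar>g x\<bar> * indicator {x. x - real n *\<^sub>R v \<in> B m} x \<partial>lborel)" for n
      by (subst (2) lborel_distr_plus[of "real n *\<^sub>R v", symmetric], subst nn_integral_distr)
         (auto simp: add.commute indicator_def)
    have "(\<integral>\<^sup>+x. (\<Sum>n. ennreal \<bar>g (x + real n *\<^sub>R v)\<bar> * indicator (B m) x) \<partial>lborel)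
        = (\<integral>\<^sup>+x. (\<Sum>n. ennreal \<bar>g x\<bar> * indicator {x. x - real n *\<^sub>R v \<in> B m} x) \<partial>lborel)"
      by (subst (1 2) nn_integral_suminf) (measurable, simp only: shift)
    also have "\<dots> \<le> (\<integral>\<^sup>+x. ennreal \<bar>g x\<bar> \<partial>lborel)"
      by (intro nn_integral_mono) (auto simp: suminf_indicator[OF disj] split: split_indicator)
    also have "\<dots> < \<infinity>"
      using g by (simp add: integrable_iff_bounded)
    finally have "AE x in lborel. (\<Sum>n. ennreal \<bar>g (x + real n *\<^sub>R v)\<bar> * indicator (B m) x) \<noteq> \<infinity>"
      by (intro nn_integral_PInf_AE) auto
    then show ?thesis
    proof (eventually_elim, safe)
      fix x assume *: "(\<Sum>n. ennreal \<bar>g (x + real n *\<^sub>R v)\<bar> * indicator (B m) x) \<noteq> \<infinity>" "x \<in> B m"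
      then have "summable (\<lambda>n. \<bar>g (x + real n *\<^sub>R v)\<bar>)"
        by (intro summable_suminf_not_top) auto
      then show "(\<lambda>n. g (x + real n *\<^sub>R v)) \<longlonglongrightarrow> 0"
        using summable_LIMSEQ_zero tendsto_rabs_zero_iff by blast
    qed
  qed
  have "AE x in lborel. \<forall>m. x \<in> B m \<longrightarrow> (\<lambda>n. g (x + real n *\<^sub>R v)) \<longlonglongrightarrow> 0"
    unfolding AE_all_countable using ae by blast
  then show ?thesis
    by eventually_elim (auto simp: B_def)
qed

text \<open>The preceding lemma applies to \<open>\<bar>F\<bar> powr p\<close> extended by
  \<open>0\<close> outside \<open>\<Omega>\<close>. An orbit that starts in \<open>\<Omega>\<close>
  stays there, so along it the extension is the function itself.\<close>

lemma Lp_fun_translates_tendsto_zero: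
  fixes F :: "'a::euclidean_space \<Rightarrow> real"
  assumes F: "F \<in> Lp_fun p \<Omega>" and \<Omega>: "\<Omega> \<in> sets lebesgue" and "0 < p" "v \<noteq> 0"
    and inv: "\<And>x. x \<in> \<Omega> \<Longrightarrow> x + v \<in> \<Omega>"
  shows "AE x in lborel. x \<in> \<Omega> \<longrightarrow> (\<lambda>n. F (x + real n *\<^sub>R v)) \<longlonglongrightarrow> 0"
proof -
  define G where "G x = indicator \<Omega> x *\<^sub>R \<bar>F x\<bar> powr p" for x
  have G: "integrable lebesgue G"
    using F \<Omega> unfolding Lp_fun_def G_def by (subst (asm) integrable_restrict_space) auto
  \<comment> \<open>\<open>G\<close> is known to be integrable only for the completed measure; a
    Borel version \<open>g\<close> brings it to \<open>lborel\<close>.\<close>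
  obtain g where g [measurable]: "g \<in> borel_measurable lborel" and Gg: "AE x in lborel. G x = g x"
    using completion_ex_borel_measurable_real[of G lborel] G by auto
  have "AE x in lebesgue. G x = g x"
    using Gg by (rule AE_completion)
  then have "integrable lebesgue g"
    using G by (subst integrable_cong_AE[of _ _ G]) (auto intro: measurable_completion)
  then have "integrable lborel g"
    using g by (simp add: integrable_completion)
  then have "AE x in lborel. (\<lambda>n. g (x + real n *\<^sub>R v)) \<longlonglongrightarrow> 0"
    using \<open>v \<noteq> 0\<close> by (rule AE_translates_tendsto_zero)
  moreover have "AE x in lborel. \<forall>n. G (x + real n *\<^sub>R v) = g (x + real n *\<^sub>R v)"
    using AE_lborel_translate[OF Gg] by (simp add: AE_all_countable)
  ultimately show ?thesis
  proof (eventually_elim, safe)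
    fix x assume lim: "(\<lambda>n. g (x + real n *\<^sub>R v)) \<longlonglongrightarrow> 0"
      and eq: "\<forall>n. G (x + real n *\<^sub>R v) = g (x + real n *\<^sub>R v)" and "x \<in> \<Omega>"
    have "x + real n *\<^sub>R v \<in> \<Omega>" for n
    proof (induction n)
      case (Suc n)
      from inv[OF this] show ?case by (simp add: algebra_simps)
    qed (simp add: \<open>x \<in> \<Omega>\<close>)
    then have "(\<lambda>n. \<bar>F (x + real n *\<^sub>R v)\<bar> powr p) \<longlonglongrightarrow> 0"
      using lim by (simp flip: eq add: G_def)
    then have "(\<lambda>n. (\<bar>F (x + real n *\<^sub>R v)\<bar> powr p) powr (1 / p)) \<longlonglongrightarrow> 0"
      by (rule tendsto_zero_powrI[OF _ tendsto_const]) (use \<open>0 < p\<close> in auto)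
    then have "(\<lambda>n. \<bar>F (x + real n *\<^sub>R v)\<bar>) \<longlonglongrightarrow> 0"
      using \<open>0 < p\<close> by (simp add: powr_powr)
    then show "(\<lambda>n. F (x + real n *\<^sub>R v)) \<longlonglongrightarrow> 0"
      using tendsto_rabs_zero_iff by blast
  qed
qed

section \<open>Ridge terms along translates\<close>

text \<open>The limit of \<open>\<phi>\<close> ignores the null set \<open>Z\<close>, so the
  arguments must avoid it. Each of the countably many translates does so for almost every
  \<open>x\<close>, hence all of them do at once.\<close>

lemma AE_ridge_translates_tendsto:
  fixes y v :: "'a::euclidean_space"
  assumes \<phi>: "tendsto_ae \<phi> c \<F>" and "y \<noteq> 0"
    and lim: "\<And>b. filterlim (\<lambda>n. b + real n * (y \<bullet> v)) \<F> sequentially"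
  shows "AE x in lborel. (\<lambda>n. \<phi> (y \<bullet> (x + real n *\<^sub>R v) + r)) \<longlonglongrightarrow> c"
proof -
  obtain Z where Z: "Z \<in> null_sets lebesgue" and \<phi>Z: "(\<phi> \<longlongrightarrow> c) (inf \<F> (principal (- Z)))"
    using \<phi> by (auto simp: tendsto_ae_def)
  have "AE x in lborel. \<forall>n. y \<bullet> (x + real n *\<^sub>R v) + r \<notin> Z"
    using AE_lborel_translate[OF AE_inner_notin_null_set[OF Z \<open>y \<noteq> 0\<close>, of r]]
    by (simp add: AE_all_countable)
  then show ?thesis
  proof eventually_elim
    fix x assume nZ: "\<forall>n. y \<bullet> (x + real n *\<^sub>R v) + r \<notin> Z"
    have "filterlim (\<lambda>n. y \<bullet> (x + real n *\<^sub>R v) + r) \<F> sequentially"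
      using lim[of "y \<bullet> x + r"] by (simp add: inner_add_right algebra_simps)
    then have "filterlim (\<lambda>n. y \<bullet> (x + real n *\<^sub>R v) + r) (inf \<F> (principal (- Z))) sequentially"
      using nZ by (simp add: filterlim_inf filterlim_principal)
    from filterlim_compose[OF \<phi>Z this]
    show "(\<lambda>n. \<phi> (y \<bullet> (x + real n *\<^sub>R v) + r)) \<longlonglongrightarrow> c" .
  qed
qed

text \<open>The sign of \<open>y \<bullet> v\<close> decides which of the two limits of
  \<open>\<phi>\<close> is reached.\<close>

lemma AE_ridge_translates_convergent:
  fixes y v :: "'a::euclidean_space"
  assumes "tendsto_ae \<phi> a at_top" "tendsto_ae \<phi> b at_bot" and "y \<bullet> v \<noteq> 0"
  shows "\<exists>c. AE x in lborel. (\<lambda>n. \<phi> (y \<bullet> (x + real n *\<^sub>R v) + r)) \<longlonglongrightarrow> c"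
proof -
  have "y \<noteq> 0"
    using assms(3) by auto
  have top: "filterlim (\<lambda>n. d + real n * e) at_top sequentially" if "0 < e" for d e
    using that
    by (intro filterlim_tendsto_add_at_top[OF tendsto_const]
        filterlim_at_top_mult_tendsto_pos[OF tendsto_const] filterlim_real_sequentially)
  show ?thesis
  proof (cases "0 < y \<bullet> v")
    case True
    then show ?thesis
      using AE_ridge_translates_tendsto[OF assms(1) \<open>y \<noteq> 0\<close> top] by blast
  next
    case False
    then have "filterlim (\<lambda>n. - d + real n * (- (y \<bullet> v))) at_top sequentially" for d
      using assms(3) by (intro top) auto
    then have "filterlim (\<lambda>n. d + real n * (y \<bullet> v)) at_bot sequentially" for d
      by (simp add: filterlim_uminus_at_bot)
    then show ?thesis
      using AE_ridge_translates_tendsto[OF assms(2) \<open>y \<noteq> 0\<close>] by blast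
  qed
qed

text \<open>The sum over \<open>I\<close> tends to zero along the orbit, its orthogonal part is
  unchanged, and the rest converges to a number independent of \<open>x\<close>. Terms with
  \<open>y i = 0\<close> belong to the orthogonal part.\<close>

lemma AE_orthogonal_ridges_constant:
  fixes y :: "'i \<Rightarrow> 'a::euclidean_space"
  assumes \<phi>: "tendsto_ae \<phi> a at_top" "tendsto_ae \<phi> b at_bot" and "finite I"
    and F: "(\<lambda>x. \<Sum>i\<in>I. t i * \<phi> (y i \<bullet> x + r i)) \<in> Lp_fun p \<Omega>"
    and \<Omega>: "\<Omega> \<in> sets lebesgue" "\<And>x. x \<in> \<Omega> \<Longrightarrow> x + v \<in> \<Omega>" and "0 < p" "v \<noteq> 0"
  shows "\<exists>C. AE x in lborel. x \<in> \<Omega> \<longrightarrow> (\<Sum>i | i \<in> I \<and> y i \<bullet> v = 0. t i * \<phi> (y i \<bullet> x + r i)) = C"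
proof -
  let ?f = "\<lambda>i x. t i * \<phi> (y i \<bullet> x + r i)"
  let ?I0 = "{i \<in> I. y i \<bullet> v = 0}" and ?I1 = "{i \<in> I. y i \<bullet> v \<noteq> 0}"
  have "\<forall>i. \<exists>c. y i \<bullet> v \<noteq> 0 \<longrightarrow>
      (AE x in lborel. (\<lambda>n. \<phi> (y i \<bullet> (x + real n *\<^sub>R v) + r i)) \<longlonglongrightarrow> c)"
    using AE_ridge_translates_convergent[OF \<phi>] by blast
  then obtain c where "\<And>i. y i \<bullet> v \<noteq> 0 \<Longrightarrow>
      AE x in lborel. (\<lambda>n. \<phi> (y i \<bullet> (x + real n *\<^sub>R v) + r i)) \<longlonglongrightarrow> c i"
    by metis
  then have "AE x in lborel. \<forall>i\<in>?I1. (\<lambda>n. \<phi> (y i \<bullet> (x + real n *\<^sub>R v) + r i)) \<longlonglongrightarrow> c i"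
    using \<open>finite I\<close> by (intro AE_finite_allI) auto
  moreover have "AE x in lborel. x \<in> \<Omega> \<longrightarrow> (\<lambda>n. \<Sum>i\<in>I. ?f i (x + real n *\<^sub>R v)) \<longlonglongrightarrow> 0"
    using F \<Omega>(1) \<open>0 < p\<close> \<open>v \<noteq> 0\<close> \<Omega>(2) by (rule Lp_fun_translates_tendsto_zero)
  ultimately have "AE x in lborel. x \<in> \<Omega> \<longrightarrow> (\<Sum>i\<in>?I0. ?f i x) = - (\<Sum>i\<in>?I1. t i * c i)"
  proof (eventually_elim, safe)
    fix x assume lim: "\<forall>i\<in>?I1. (\<lambda>n. \<phi> (y i \<bullet> (x + real n *\<^sub>R v) + r i)) \<longlonglongrightarrow> c i"
      and zero: "(\<lambda>n. \<Sum>i\<in>I. ?f i (x + real n *\<^sub>R v)) \<longlonglongrightarrow> 0"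
    have "(\<Sum>i\<in>I. ?f i z) = (\<Sum>i\<in>?I0. ?f i z) + (\<Sum>i\<in>?I1. ?f i z)" for z
      using \<open>finite I\<close> by (subst sum.union_disjoint[symmetric]) (auto intro: sum.cong)
    moreover have "(\<Sum>i\<in>?I0. ?f i (x + real n *\<^sub>R v)) = (\<Sum>i\<in>?I0. ?f i x)" for n
      by (intro sum.cong) (auto simp: inner_add_right)
    ultimately have "(\<lambda>n. \<Sum>i\<in>I. ?f i (x + real n *\<^sub>R v)) \<longlonglongrightarrow> (\<Sum>i\<in>?I0. ?f i x) + (\<Sum>i\<in>?I1. t i * c i)"
      using lim by (auto intro!: tendsto_intros)
    from LIMSEQ_unique[OF this zero]
    show "(\<Sum>i\<in>?I0. ?f i x) = - (\<Sum>i\<in>?I1. t i * c i)"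
      by simp
  qed
  then show ?thesis ..
qed

text \<open>A representative of the normal direction that depends only on the line spanned by \<open>y\<close> and
  whose translation preserves the upper half plane.\<close>

definition upward_normal :: "real ^ 2 \<Rightarrow> real ^ 2" where
  "upward_normal y = (if y $ 1 = 0 then vector [1, 0] else vector [- (y $ 2 / y $ 1), 1])"

lemma upward_normal_nonzero: "upward_normal y \<noteq> 0"
  by (auto simp: upward_normal_def vec_eq_iff forall_2)

lemma upward_normal_preserves: "x \<in> upper_half_plane \<Longrightarrow> x + upward_normal y \<in> upper_half_plane"
  by (auto simp: upward_normal_def upper_half_plane_def)

text \<open>In the plane, a nonzero vector orthogonal to a given normal spans the one line with that
  normal, and \<open>upward_normal\<close> is normalised to be unique for each line. Equality of
  normals thus sorts the ridge directions into lines.\<close>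

lemma inner_upward_normal_eq_0_iff:
  assumes "y \<noteq> 0"
  shows "y \<bullet> upward_normal z = 0 \<longleftrightarrow> upward_normal y = upward_normal z"
  using assms
  by (auto simp: upward_normal_def inner_vec_def sum_2 vec_eq_iff forall_2 field_simps)

lemma sets_upper_half_plane: "upper_half_plane \<in> sets lebesgue"
proof -
  have "open upper_half_plane"
    unfolding upper_half_plane_def by (intro open_Collect_less continuous_intros)
  then show ?thesis
    by auto
qed

theorem proposition4p3:
  fixes \<phi> :: "real \<Rightarrow> real" and p :: real
  assumes "\<phi> \<in> borel_measurable lebesgue"
    and "essentially_bounded \<phi>"
    and "\<exists>c. tendsto_ae \<phi> c at_top"
    and "\<exists>c. tendsto_ae \<phi> c at_bot"
    and "1 \<le> p"
  shows "Lp_class p upper_half_plane ` (ridge_sums \<phi> \<inter> Lp_fun p upper_half_plane)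
           = {Lp_class p upper_half_plane (\<lambda>_. 0)}"
  unfolding Lp_class_image_eq_zero_iff
proof
  fix F assume "F \<in> ridge_sums \<phi> \<inter> Lp_fun p upper_half_plane"
  then obtain k t and y :: "nat \<Rightarrow> real ^ 2" and r
    where F: "F = (\<lambda>x. \<Sum>i<k. t i * \<phi> (y i \<bullet> x + r i))" and Lp: "F \<in> Lp_fun p upper_half_plane"
    by (auto simp: ridge_sums_def)
  obtain a b where \<phi>: "tendsto_ae \<phi> a at_top" "tendsto_ae \<phi> b at_bot"
    using assms by blast
  let ?f = "\<lambda>i x. t i * \<phi> (y i \<bullet> x + r i)"
  define N where "N = {i. i < k \<and> y i \<noteq> 0}"
  \<comment> \<open>Terms with zero direction are constant and span no line, so they are kept apart
    from the grouping by \<open>W\<close>.\<close>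
  define c0 where "c0 = (\<Sum>i | i < k \<and> y i = 0. t i * \<phi> (r i))"
  define W where "W = (upward_normal \<circ> y) ` N"
  have fin: "finite N" "finite W"
    by (auto simp: N_def W_def)
  have "\<exists>C. AE x in lborel. x \<in> upper_half_plane \<longrightarrow>
      (\<Sum>i | i \<in> N \<and> upward_normal (y i) = w. ?f i x) = C" if "w \<in> W" for w
  proof -
    obtain z where w: "w = upward_normal z"
      using \<open>w \<in> W\<close> by (auto simp: W_def)
    obtain C where C: "AE x in lborel. x \<in> upper_half_plane \<longrightarrow>
        (\<Sum>i | i \<in> {..<k} \<and> y i \<bullet> w = 0. ?f i x) = C"
      using AE_orthogonal_ridges_constant[OF \<phi> finite_lessThan Lp[unfolded F] sets_upper_half_plane
          upward_normal_preserves _ upward_normal_nonzero, of z] assms(5)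
      by (auto simp: w)
    \<comment> \<open>Zero directions are orthogonal to every \<open>w\<close>; they enter each
      orthogonal sum and contribute \<open>c0\<close>, which is subtracted from
      \<open>C\<close>.\<close>
    have "{i. i \<in> {..<k} \<and> y i \<bullet> w = 0}
        = {i. i < k \<and> y i = 0} \<union> {i. i \<in> N \<and> upward_normal (y i) = w}"
      using inner_upward_normal_eq_0_iff[of _ z] by (auto simp: N_def w)
    then have "(\<Sum>i | i \<in> {..<k} \<and> y i \<bullet> w = 0. ?f i x)
        = c0 + (\<Sum>i | i \<in> N \<and> upward_normal (y i) = w. ?f i x)" for x
      by (subst \<open>_ = _ \<union> _\<close>, subst sum.union_disjoint) (auto simp: c0_def N_def)
    then have "AE x in lborel. x \<in> upper_half_plane \<longrightarrow>
        (\<Sum>i | i \<in> N \<and> upward_normal (y i) = w. ?f i x) = C - c0"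
      using C by (auto elim!: eventually_mono)
    then show ?thesis ..
  qed
  then have "\<forall>w\<in>W. \<exists>C. AE x in lborel. x \<in> upper_half_plane \<longrightarrow>
      (\<Sum>i | i \<in> N \<and> upward_normal (y i) = w. ?f i x) = C"
    by blast
  from bchoice[OF this] obtain C where "\<forall>w\<in>W. AE x in lborel. x \<in> upper_half_plane \<longrightarrow>
      (\<Sum>i | i \<in> N \<and> upward_normal (y i) = w. ?f i x) = C w" ..
  then have "AE x in lborel. \<forall>w\<in>W. x \<in> upper_half_plane \<longrightarrow>
      (\<Sum>i | i \<in> N \<and> upward_normal (y i) = w. ?f i x) = C w"
    using fin by (intro AE_finite_allI) auto
  moreover have "F x = c0 + (\<Sum>w\<in>W. \<Sum>i | i \<in> N \<and> upward_normal (y i) = w. ?f i x)" for x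
  proof -
    have "{..<k} = {i. i < k \<and> y i = 0} \<union> N"
      by (auto simp: N_def)
    then have "F x = c0 + (\<Sum>i\<in>N. ?f i x)"
      unfolding F by (simp only:, subst sum.union_disjoint) (auto simp: c0_def N_def)
    \<comment> \<open>The fibres of \<open>upward_normal \<circ> y\<close> partition
      \<open>N\<close>, one for each line.\<close>
    also have "(\<Sum>i\<in>N. ?f i x) = (\<Sum>w\<in>W. \<Sum>i | i \<in> N \<and> (upward_normal \<circ> y) i = w. ?f i x)"
      unfolding W_def using fin(1) by (rule sum.image_gen)
    finally show ?thesis
      by simp
  qed
  ultimately have const: "AE x in lborel. x \<in> upper_half_plane \<longrightarrow> F x = c0 + (\<Sum>w\<in>W. C w)"
    by (auto elim!: eventually_mono intro!: sum.cong)
  \<comment> \<open>The value at \<open>0\<close> is the horizontal unit vector, so the orbits run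
    parallel to the boundary of the half plane.\<close>
  define v where "v = upward_normal 0"
  have "AE x in lborel. \<forall>n. x + real n *\<^sub>R v \<in> upper_half_plane \<longrightarrow>
      F (x + real n *\<^sub>R v) = c0 + (\<Sum>w\<in>W. C w)"
    using AE_lborel_translate[OF const] by (simp add: AE_all_countable)
  moreover have "AE x in lborel. x \<in> upper_half_plane \<longrightarrow> (\<lambda>n. F (x + real n *\<^sub>R v)) \<longlonglongrightarrow> 0"
    unfolding v_def using Lp sets_upper_half_plane _ upward_normal_nonzero upward_normal_preserves
    by (rule Lp_fun_translates_tendsto_zero) (use assms(5) in simp)
  ultimately have "AE x in lborel. x \<in> upper_half_plane \<longrightarrow> F x = 0"
    using const
  proof (eventually_elim, safe)
    fix x assume eq: "\<forall>n. x + real n *\<^sub>R v \<in> upper_half_plane \<longrightarrow>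
          F (x + real n *\<^sub>R v) = c0 + (\<Sum>w\<in>W. C w)"
      and "x \<in> upper_half_plane" and lim: "(\<lambda>n. F (x + real n *\<^sub>R v)) \<longlonglongrightarrow> 0"
      and Fx: "F x = c0 + (\<Sum>w\<in>W. C w)"
    then have "x + real n *\<^sub>R v \<in> upper_half_plane" for n
      by (auto simp: v_def upward_normal_def upper_half_plane_def)
    then show "F x = 0"
      using lim Fx eq by (simp add: LIMSEQ_const_iff)
  qed
  then show "AE x in lebesgue_on upper_half_plane. F x = 0"
    using sets_upper_half_plane by (simp add: AE_restrict_space_iff AE_completion_iff)
qed

end
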